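(* Every J-clean ring is NJ-reflexive.
   Context: All rings are associative with unity. $N(R)$ denotes the set of nilpotent elements of a ring $R$, $E(R)$ the set of idempotents of $R$, and $J(R)$ the Jacobson radical of $R$. A ring $R$ is NJ-reflexive if for all $x,y\in R$, $xRy\subseteq N(R)$ implies $yRx\subseteq J(R)$. A ring $R$ is J-clean if every $x\in R$ can be written as $x=e+j$ with $e\in E(R)$ and $j\in J(R)$. *)

theory Defs
  imports "HOL-Algebra.Ideal"
begin

definition nilpotents :: "('a, 'm) ring_scheme \<Rightarrow> 'a set" where
  "nilpotents R = {x \<in> carrier R. \<exists>n::nat. 0 < n \<and> x [^]\<^bsub>R\<^esub> n = \<zero>\<^bsub>R\<^esub>}"

definition idempotents :: "('a, 'm) ring_scheme \<Rightarrow> 'a set" where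
  "idempotents R = {e \<in> carrier R. e \<otimes>\<^bsub>R\<^esub> e = e}"

text \<open>HOL-Algebra's \<open>ideal\<close> and \<open>maximalideal\<close> are two-sided; over a noncommutative ring the
  Jacobson radical has to be defined through one-sided ideals.\<close>

definition left_ideal :: "'a set \<Rightarrow> ('a, 'm) ring_scheme \<Rightarrow> bool" where
  "left_ideal I R \<longleftrightarrow> additive_subgroup I R \<and> (\<forall>x\<in>carrier R. \<forall>a\<in>I. x \<otimes>\<^bsub>R\<^esub> a \<in> I)"

definition maximal_left_ideal :: "'a set \<Rightarrow> ('a, 'm) ring_scheme \<Rightarrow> bool" where
  "maximal_left_ideal M R \<longleftrightarrow> left_ideal M R \<and> M \<noteq> carrier R \<and>
     (\<forall>I. left_ideal I R \<longrightarrow> M \<subseteq> I \<longrightarrow> I = M \<or> I = carrier R)"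

text \<open>The intersection is taken inside the carrier, so that the radical of the zero ring, which has
  no maximal left ideals, is the whole ring.\<close>

definition jacobson_radical :: "('a, 'm) ring_scheme \<Rightarrow> 'a set" where
  "jacobson_radical R = carrier R \<inter> \<Inter>{M. maximal_left_ideal M R}"

definition NJ_reflexive :: "('a, 'm) ring_scheme \<Rightarrow> bool" where
  "NJ_reflexive R \<longleftrightarrow> (\<forall>x\<in>carrier R. \<forall>y\<in>carrier R.
     (\<lambda>r. x \<otimes>\<^bsub>R\<^esub> r \<otimes>\<^bsub>R\<^esub> y) ` carrier R \<subseteq> nilpotents R \<longrightarrow>
     (\<lambda>r. y \<otimes>\<^bsub>R\<^esub> r \<otimes>\<^bsub>R\<^esub> x) ` carrier R \<subseteq> jacobson_radical R)"

definition J_clean :: "('a, 'm) ring_scheme \<Rightarrow> bool" where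
  "J_clean R \<longleftrightarrow> (\<forall>x\<in>carrier R. \<exists>e\<in>idempotents R. \<exists>j\<in>jacobson_radical R. x = e \<oplus>\<^bsub>R\<^esub> j)"

end

theory Submission
  imports Defs
begin

text \<open>
  Modulo its Jacobson radical \<open>J\<close>, a J-clean ring \<open>R\<close> is Boolean: if \<open>x = e + j\<close>, then
  \<open>x - x\<^sup>2\<close> lies in \<open>J\<close>. A Boolean ring has no nonzero nilpotents, so every nilpotent of \<open>R\<close>
  lies in \<open>J\<close>. If \<open>xRy\<close> consists of nilpotents, then in particular \<open>xy \<in> J\<close>. For \<open>z = yrx\<close> this
  gives \<open>z\<^sup>2 = yr(xy)rx \<in> J\<close>, and \<open>z - z\<^sup>2 \<in> J\<close> then yields \<open>z \<in> J\<close>.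

  The argument rests on \<open>J\<close> being a two-sided ideal, although it is defined through maximal left ideals.
  It is closed under multiplication from the right (\<open>jacobson_radical_mult_right\<close>) because, for a
  maximal left ideal \<open>M\<close> and a ring element \<open>r \<notin> M\<close>, the set of all \<open>s\<close> with \<open>sr \<in> M\<close> is
  again a maximal left ideal.
\<close>

section \<open>Left ideals\<close>

lemma left_ideal_subset: "left_ideal I R \<Longrightarrow> I \<subseteq> carrier R"
  unfolding left_ideal_def by (blast dest: additive_subgroup.a_subset)

lemma left_ideal_mult:
  "left_ideal I R \<Longrightarrow> x \<in> carrier R \<Longrightarrow> a \<in> I \<Longrightarrow> x \<otimes>\<^bsub>R\<^esub> a \<in> I"
  unfolding left_ideal_def by blast

lemma left_ideal_zero: "left_ideal I R \<Longrightarrow> \<zero>\<^bsub>R\<^esub> \<in> I"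
  unfolding left_ideal_def by (blast intro: additive_subgroup.zero_closed)

lemma left_ideal_add:
  "left_ideal I R \<Longrightarrow> a \<in> I \<Longrightarrow> b \<in> I \<Longrightarrow> a \<oplus>\<^bsub>R\<^esub> b \<in> I"
  unfolding left_ideal_def by (blast intro: additive_subgroup.a_closed)

lemma maximal_left_ideal_imp_left_ideal: "maximal_left_ideal M R \<Longrightarrow> left_ideal M R"
  unfolding maximal_left_ideal_def by blast

context ring
begin

text \<open>Closure under negation comes for free, since \<open>-a = (-1)a\<close>.\<close>

lemma left_idealI:
  assumes sub: "I \<subseteq> carrier R"
    and zero: "\<zero> \<in> I"
    and add: "\<And>a b. a \<in> I \<Longrightarrow> b \<in> I \<Longrightarrow> a \<oplus> b \<in> I"
    and mult: "\<And>x a. x \<in> carrier R \<Longrightarrow> a \<in> I \<Longrightarrow> x \<otimes> a \<in> I"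
  shows "left_ideal I R"
proof -
  have neg: "\<ominus> a \<in> I" if "a \<in> I" for a
    using mult[of "\<ominus> \<one>" a] that sub by (auto simp: l_minus)
  have "subgroup I (add_monoid R)"
    by (rule add.subgroupI) (use sub zero add neg in \<open>auto simp: a_inv_def\<close>)
  then show ?thesis
    using mult by (simp add: left_ideal_def additive_subgroup_def)
qed

lemma left_ideal_minus:
  assumes "left_ideal I R" "a \<in> I" "b \<in> I"
  shows "a \<ominus> b \<in> I"
proof -
  have "b \<in> carrier R"
    using assms left_ideal_subset by blast
  then have "\<ominus> b \<in> I"
    using left_ideal_mult[OF assms(1), of "\<ominus> \<one>" b] assms(3) by (simp add: l_minus)
  then show ?thesis
    using left_ideal_add[OF assms(1,2)] by (simp add: a_minus_def)
qed

lemma left_ideal_one_imp_carrier: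
  assumes "left_ideal I R" "\<one> \<in> I"
  shows "I = carrier R"
proof
  show "I \<subseteq> carrier R"
    by (rule left_ideal_subset[OF assms(1)])
  show "carrier R \<subseteq> I"
  proof
    fix x assume "x \<in> carrier R"
    then show "x \<in> I"
      using left_ideal_mult[OF assms(1) _ assms(2), of x] by simp
  qed
qed

lemma left_ideal_colon:
  assumes M: "left_ideal M R" and r: "r \<in> carrier R"
  shows "left_ideal {s \<in> carrier R. s \<otimes> r \<in> M} R"
  by (rule left_idealI)
    (use r in \<open>auto simp: l_distr m_assoc
      intro: left_ideal_zero[OF M] left_ideal_add[OF M] left_ideal_mult[OF M]\<close>)

lemma left_ideal_add_principal:
  assumes M: "left_ideal M R" and a: "a \<in> carrier R"
  shows "left_ideal {m \<oplus> t \<otimes> a | m t. m \<in> M \<and> t \<in> carrier R} R" (is "left_ideal ?I R")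
proof (rule left_idealI)
  note sub = left_ideal_subset[OF M]
  show "?I \<subseteq> carrier R"
    using sub a by auto
  have "\<zero> = \<zero> \<oplus> \<zero> \<otimes> a"
    using a by simp
  then show "\<zero> \<in> ?I"
    using left_ideal_zero[OF M] zero_closed by blast
  fix u v assume "u \<in> ?I" "v \<in> ?I"
  then obtain m t m' t' where *: "m \<in> M" "t \<in> carrier R" "m' \<in> M" "t' \<in> carrier R"
    and uv: "u = m \<oplus> t \<otimes> a" "v = m' \<oplus> t' \<otimes> a" by blast
  then have c: "m \<in> carrier R" "m' \<in> carrier R"
    using sub by auto
  have "u \<oplus> v = (m \<oplus> m') \<oplus> (t \<oplus> t') \<otimes> a"
    using * c a by (simp add: uv l_distr a_ac)
  then show "u \<oplus> v \<in> ?I"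
    using * left_ideal_add[OF M] by blast
next
  fix x u assume x: "x \<in> carrier R" and "u \<in> ?I"
  then obtain m t where *: "m \<in> M" "t \<in> carrier R" "u = m \<oplus> t \<otimes> a" by blast
  then have "m \<in> carrier R"
    using left_ideal_subset[OF M] by auto
  then have "x \<otimes> u = x \<otimes> m \<oplus> (x \<otimes> t) \<otimes> a"
    using * x a by (simp add: r_distr m_assoc)
  then show "x \<otimes> u \<in> ?I"
    using * x left_ideal_mult[OF M] by blast
qed

text \<open>The map \<open>s \<mapsto> sr + M\<close> from \<open>R\<close> to the simple module \<open>R/M\<close> is nonzero, hence onto, and its
  kernel is therefore a maximal left ideal. The proof carries this out on elements: a left ideal
  \<open>I\<close> properly above the kernel has an element \<open>i\<close> with \<open>ir \<notin> M\<close>, so \<open>M + Rir = R\<close>. Writing \<open>r\<close> in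
  this sum as \<open>m + tir\<close> puts \<open>1 - ti\<close> into the kernel, and thus \<open>1\<close> into \<open>I\<close>.\<close>

lemma maximal_left_ideal_colon:
  assumes max: "maximal_left_ideal M R" and r: "r \<in> carrier R" and rM: "r \<notin> M"
  shows "maximal_left_ideal {s \<in> carrier R. s \<otimes> r \<in> M} R" (is "maximal_left_ideal ?L R")
  unfolding maximal_left_ideal_def
proof (intro conjI allI impI)
  note M = maximal_left_ideal_imp_left_ideal[OF max]
  show "left_ideal ?L R"
    by (rule left_ideal_colon[OF M r])
  have "\<one> \<notin> ?L"
    using r rM by simp
  then show "?L \<noteq> carrier R"
    using one_closed by blast
  fix I assume I: "left_ideal I R" and LI: "?L \<subseteq> I"
  show "I = ?L \<or> I = carrier R"
  proof (cases "I = ?L")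
    case False
    then obtain i where i: "i \<in> I" "i \<in> carrier R" "i \<otimes> r \<notin> M"
      using LI left_ideal_subset[OF I] by blast
    let ?N = "{m \<oplus> t \<otimes> (i \<otimes> r) | m t. m \<in> M \<and> t \<in> carrier R}"
    have N: "left_ideal ?N R"
      using left_ideal_add_principal[OF M] i r by simp
    have MN: "M \<subseteq> ?N"
    proof
      fix m assume m: "m \<in> M"
      then have "m = m \<oplus> \<zero> \<otimes> (i \<otimes> r)"
        using i r left_ideal_subset[OF M] by auto
      then show "m \<in> ?N"
        using m zero_closed by blast
    qed
    have "i \<otimes> r = \<zero> \<oplus> \<one> \<otimes> (i \<otimes> r)"
      using i r by simp
    then have "i \<otimes> r \<in> ?N"
      using left_ideal_zero[OF M] one_closed by blast
    then have "?N = carrier R"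
      using max N MN i(3) unfolding maximal_left_ideal_def by blast
    then obtain m t where mt: "m \<in> M" "t \<in> carrier R" "r = m \<oplus> t \<otimes> (i \<otimes> r)"
      using r by blast
    have mc: "m \<in> carrier R"
      using mt left_ideal_subset[OF M] by blast
    have "(\<one> \<ominus> t \<otimes> i) \<otimes> r = r \<ominus> t \<otimes> (i \<otimes> r)"
      using i r mt(2) by (simp add: a_minus_def l_distr l_minus m_assoc)
    also have "\<dots> = (m \<oplus> t \<otimes> (i \<otimes> r)) \<ominus> t \<otimes> (i \<otimes> r)"
      by (simp only: mt(3)[symmetric])
    also have "\<dots> = m"
      using mc i r mt(2) by (simp add: a_minus_def a_assoc r_neg)
    finally have "\<one> \<ominus> t \<otimes> i \<in> I"
      using LI mt i by auto
    then have "(\<one> \<ominus> t \<otimes> i) \<oplus> t \<otimes> i \<in> I"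
      using left_ideal_add[OF I] left_ideal_mult[OF I mt(2) i(1)] by blast
    moreover have "(\<one> \<ominus> t \<otimes> i) \<oplus> t \<otimes> i = \<one>"
      using mt(2) i by (simp add: a_minus_def a_assoc l_neg)
    ultimately show ?thesis
      using left_ideal_one_imp_carrier[OF I] by simp
  qed simp
qed

section \<open>The Jacobson radical as a two-sided ideal\<close>

lemma left_ideal_jacobson_radical: "left_ideal (jacobson_radical R) R"
  by (rule left_idealI)
    (auto simp: jacobson_radical_def
      intro: left_ideal_zero left_ideal_add left_ideal_mult maximal_left_ideal_imp_left_ideal)

lemma jacobson_radical_mult_right:
  assumes j: "j \<in> jacobson_radical R" and r: "r \<in> carrier R"
  shows "j \<otimes> r \<in> jacobson_radical R"
proof -
  have jc: "j \<in> carrier R"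
    using j by (simp add: jacobson_radical_def)
  have "j \<otimes> r \<in> M" if M: "maximal_left_ideal M R" for M
  proof (cases "r \<in> M")
    case True
    then show ?thesis
      using M jc by (blast intro: left_ideal_mult maximal_left_ideal_imp_left_ideal)
  next
    case False
    then show ?thesis
      using maximal_left_ideal_colon[OF M r] j unfolding jacobson_radical_def by blast
  qed
  then show ?thesis
    using jc r by (simp add: jacobson_radical_def)
qed

section \<open>J-clean rings\<close>

text \<open>With \<open>x = e + j\<close> and \<open>e\<^sup>2 = e\<close> one has \<open>x - x\<^sup>2 = j - (ej + jx)\<close>, and both sides of the
  difference lie in the radical because it is a two-sided ideal.\<close>

lemma J_clean_minus_square:
  assumes "J_clean R" and x: "x \<in> carrier R"
  shows "x \<ominus> x \<otimes> x \<in> jacobson_radical R"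
proof -
  note J = left_ideal_jacobson_radical
  obtain e j where e: "e \<in> carrier R" "e \<otimes> e = e" and j: "j \<in> jacobson_radical R"
    and xej: "x = e \<oplus> j"
    using assms unfolding J_clean_def idempotents_def by blast
  have jc: "j \<in> carrier R"
    using j by (simp add: jacobson_radical_def)
  have "x \<otimes> x = e \<oplus> (e \<otimes> j \<oplus> j \<otimes> x)"
  proof -
    have "x \<otimes> x = e \<otimes> x \<oplus> j \<otimes> x"
      using e jc x l_distr[of e j x] by (simp flip: xej)
    also have "e \<otimes> x = e \<oplus> e \<otimes> j"
      using e jc by (simp add: xej r_distr)
    finally show ?thesis
      using e jc x by (simp add: a_assoc)
  qed
  then have "x \<ominus> x \<otimes> x = (e \<oplus> j) \<ominus> (e \<oplus> (e \<otimes> j \<oplus> j \<otimes> x))"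
    by (simp add: xej)
  also have "\<dots> = (e \<oplus> \<ominus> e) \<oplus> (j \<ominus> (e \<otimes> j \<oplus> j \<otimes> x))"
    using e(1) jc x by (simp add: a_minus_def minus_add a_ac)
  also have "\<dots> = j \<ominus> (e \<otimes> j \<oplus> j \<otimes> x)"
    using e(1) jc x by (simp add: r_neg)
  also have "\<dots> \<in> jacobson_radical R"
    by (intro left_ideal_minus[OF J] left_ideal_add[OF J] left_ideal_mult[OF J]
        jacobson_radical_mult_right e(1) j x)
  finally show ?thesis .
qed

text \<open>If \<open>x\<^bsup>n+2\<^esup>\<close> lies in the radical, so does \<open>x\<^bsup>n+1\<^esup>\<close>, because the difference of the two is
  \<open>x\<^sup>n(x - x\<^sup>2)\<close>.\<close>

lemma J_clean_pow_in_jacobson_radical: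
  assumes "J_clean R" and x: "x \<in> carrier R"
  shows "x [^] Suc n \<in> jacobson_radical R \<Longrightarrow> x \<in> jacobson_radical R"
proof (induction n)
  case 0
  then show ?case
    using x by simp
next
  case (Suc n)
  note J = left_ideal_jacobson_radical
  let ?p = "x [^] n"
  have p: "?p \<in> carrier R"
    using x by simp
  have "?p \<otimes> (x \<ominus> x \<otimes> x) \<oplus> x [^] Suc (Suc n) \<in> jacobson_radical R"
    using J Suc.prems left_ideal_mult[OF J p J_clean_minus_square[OF assms]]
    by (blast intro: left_ideal_add)
  also have "?p \<otimes> (x \<ominus> x \<otimes> x) \<oplus> x [^] Suc (Suc n) = x [^] Suc n"
    using x p by (simp add: a_minus_def r_distr r_minus m_assoc a_assoc l_neg)
  finally show ?case
    by (rule Suc.IH)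
qed

lemma J_clean_nilpotents_subset_jacobson_radical:
  assumes "J_clean R"
  shows "nilpotents R \<subseteq> jacobson_radical R"
proof
  fix x assume "x \<in> nilpotents R"
  then obtain n :: nat where x: "x \<in> carrier R" and n: "0 < n" "x [^] n = \<zero>"
    by (auto simp: nilpotents_def)
  then have "x [^] Suc (n - 1) \<in> jacobson_radical R"
    using left_ideal_zero[OF left_ideal_jacobson_radical] by simp
  then show "x \<in> jacobson_radical R"
    by (rule J_clean_pow_in_jacobson_radical[OF assms x])
qed

lemma J_clean_imp_NJ_reflexive:
  assumes clean: "J_clean R"
  shows "NJ_reflexive R"
  unfolding NJ_reflexive_def
proof (intro ballI impI image_subsetI)
  fix x y r
  assume x: "x \<in> carrier R" and y: "y \<in> carrier R" and r: "r \<in> carrier R"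
    and nil: "(\<lambda>r. x \<otimes> r \<otimes> y) ` carrier R \<subseteq> nilpotents R"
  have "x \<otimes> \<one> \<otimes> y \<in> nilpotents R"
    using nil one_closed by blast
  then have xy: "x \<otimes> y \<in> jacobson_radical R"
    using J_clean_nilpotents_subset_jacobson_radical[OF clean] x by auto
  let ?z = "y \<otimes> r \<otimes> x"
  have z: "?z \<in> carrier R"
    using x y r by simp
  have "(y \<otimes> r) \<otimes> (x \<otimes> y) \<otimes> (r \<otimes> x) \<in> jacobson_radical R"
    using jacobson_radical_mult_right[OF left_ideal_mult[OF left_ideal_jacobson_radical _ xy]]
      x y r by simp
  moreover have "(y \<otimes> r) \<otimes> (x \<otimes> y) \<otimes> (r \<otimes> x) = ?z [^] Suc 1"
    using x y r by (simp add: m_assoc)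
  ultimately show "?z \<in> jacobson_radical R"
    using J_clean_pow_in_jacobson_radical[OF clean z] by metis
qed

end

theorem theorem2p12:
  fixes R :: "('a, 'm) ring_scheme"
  assumes "ring R"
    and "J_clean R"
  shows "NJ_reflexive R"
  using assms by (rule ring.J_clean_imp_NJ_reflexive)

end
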